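(* Let $X$ be an integer-valued random variable with regularly-varying probability mass function $f$ with exponent $\gamma>1$, and suppose that $f(k)>0$ for all $k>0$. For each $n$ let $\mathbf{X}_n=\{X_1,\dots,X_n\}$ where $X_1,\dots,X_n$ are independent copies of $X$. Then for any $0<a<\frac{1}{\gamma+1}$, $$\lim_{n\to\infty}\mathbb{P}\left(\{1,2,\ldots,\lceil n^a\rceil\}\subseteq \mathbf{X}_n\right)=1.$$ On the other hand, if $a>\frac{1}{\gamma+1}$, then $$\lim_{n\to\infty}\mathbb{P}\left(\lceil n^a\rceil\in \mathbf{X}_n\right)=0.$$
   Context: The probability mass function $f(k)=\mathbb{P}(X=k)$ is called regularly varying with exponent $\gamma>1$ if $f(k)=l(k)k^{-\gamma-1}$ for $k=1,2,\dots$, where $l$ is a slowly-varying function, i.e. $\lim_{x\to\infty} l(\lambda x)/l(x)=1$ for every $\lambda>0$. It is assumed throughout that $l$ is eventually monotone. *)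

theory Defs
  imports "HOL-Probability.Probability"
begin

definition slowly_varying :: "(real \<Rightarrow> real) \<Rightarrow> bool" where
  "slowly_varying l \<longleftrightarrow> (\<forall>c>0. ((\<lambda>x. l (c * x) / l x) \<longlongrightarrow> 1) at_top)"

definition eventually_monotone :: "(real \<Rightarrow> real) \<Rightarrow> bool" where
  "eventually_monotone l \<longleftrightarrow> (\<exists>x0. mono_on {x0..} l \<or> antimono_on {x0..} l)"

definition prob_mass :: "'a measure \<Rightarrow> ('a \<Rightarrow> int) \<Rightarrow> int \<Rightarrow> real" where
  "prob_mass M X k = measure M {\<omega> \<in> space M. X \<omega> = k}"

text \<open>Eventual monotonicity of the slowly varying factor is a standing assumption and is
  therefore part of the definition. The condition \<open>\<gamma> > 1\<close> is not; it is
  imposed where the notion is used.\<close>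

definition regularly_varying_pmf :: "(int \<Rightarrow> real) \<Rightarrow> real \<Rightarrow> bool" where
  "regularly_varying_pmf f \<gamma> \<longleftrightarrow>
     (\<exists>l. slowly_varying l \<and> eventually_monotone l \<and>
          (\<forall>k\<ge>1. f k = l (of_int k) * of_int k powr (- \<gamma> - 1)))"

text \<open>The copies may live on a probability space other than that of \<open>X\<close>.\<close>

definition independent_copies ::
    "'a measure \<Rightarrow> ('a \<Rightarrow> int) \<Rightarrow> 'b measure \<Rightarrow> (nat \<Rightarrow> 'b \<Rightarrow> int) \<Rightarrow> nat \<Rightarrow> bool" where
  "independent_copies M X N Y n \<longleftrightarrow>
     prob_space.indep_vars N (\<lambda>_. count_space UNIV) Y {1..n} \<and>
     (\<forall>i\<in>{1..n}. distr N (count_space UNIV) (Y i) = distr M (count_space UNIV) X)"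

definition sample_set :: "(nat \<Rightarrow> 'b \<Rightarrow> int) \<Rightarrow> nat \<Rightarrow> 'b \<Rightarrow> int set" where
  "sample_set Y n \<omega> = (\<lambda>i. Y i \<omega>) ` {1..n}"

end

theory Submission
  imports Defs "HOL-Real_Asymp.Real_Asymp"
begin

text \<open>
  A slowly varying, eventually monotone \<open>l\<close> satisfies
  \<open>c * k powr (- \<epsilon>) \<le> l k \<le> C * k powr \<epsilon>\<close>: iterate \<open>l (2 * x) \<le> 2 powr \<epsilon> * l x\<close>,
  monotonicity controlling \<open>l\<close> on a first interval \<open>[x, 2 x]\<close>; the lower bound is the upper
  bound for \<open>1 / l\<close>. Hence the mass function decays like \<open>k powr (- \<gamma> - 1 + o(1))\<close>. With
  \<open>K = \<lceil>n powr a\<rceil>\<close>, the union bound over the values \<open>k \<le> K\<close> bounds the probability of missing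
  one of them by \<open>\<Sum>k\<le>K. (1 - f k) ^ n \<le> K * exp (- n * min f)\<close>, which tends to 0 when
  \<open>a * (\<gamma> + 1) < 1\<close>; the union bound over the sample bounds the probability of hitting \<open>K\<close> by
  \<open>n * f K\<close>, which tends to 0 when \<open>a * (\<gamma> + 1) > 1\<close>.
\<close>

section \<open>Power bounds for slowly varying functions\<close>

lemma slowly_varying_inverse:
  assumes "slowly_varying l"
  shows "slowly_varying (\<lambda>x. inverse (l x))"
  unfolding slowly_varying_def
proof (intro allI impI)
  fix c :: real assume "c > 0"
  then have "((\<lambda>x. inverse (l (c * x) / l x)) \<longlongrightarrow> inverse 1) at_top"
    using assms unfolding slowly_varying_def by (intro tendsto_inverse) auto
  then show "((\<lambda>x. inverse (l (c * x)) / inverse (l x)) \<longlongrightarrow> 1) at_top"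
    by (simp add: divide_simps)
qed

text \<open>A mass function controls \<open>l\<close> at integers only. Monotonicity carries
  positivity to a real \<open>x\<close> from a neighbouring integer: the floor if \<open>l\<close>
  increases, the ceiling if it decreases.\<close>

lemma eventually_monotone_imp_eventually_pos:
  assumes "eventually_monotone l" and pos: "\<And>k::int. k \<ge> 1 \<Longrightarrow> l (of_int k) > 0"
  shows "\<forall>\<^sub>F x in at_top. l x > 0"
proof -
  obtain x0 where x0: "mono_on {x0..} l \<or> antimono_on {x0..} l"
    using assms(1) unfolding eventually_monotone_def by blast
  \<comment> \<open>The margin 1 keeps the floor of \<open>x\<close> above \<open>x0\<close> and at
    least 1.\<close>
  have "l x > 0" if x: "x \<ge> max x0 0 + 1" for x
    using x0
  proof
    assume m: "mono_on {x0..} l"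
    have "l \<lfloor>x\<rfloor> \<le> l x"
      by (rule monotone_onD[OF m]) (use x in \<open>auto simp: le_floor_iff\<close>, linarith+)
    moreover have "l \<lfloor>x\<rfloor> > 0" using x by (intro pos) (simp add: le_floor_iff)
    ultimately show ?thesis by linarith
  next
    assume m: "antimono_on {x0..} l"
    have "l \<lceil>x\<rceil> \<le> l x"
      by (rule monotone_onD[OF m]) (use x in \<open>auto\<close>, linarith+)
    moreover have "l \<lceil>x\<rceil> > 0" using x by (intro pos) linarith
    ultimately show ?thesis by linarith
  qed
  then show ?thesis unfolding eventually_at_top_linorder by blast
qed

text \<open>Together with \<open>slowly_varying_inverse\<close>, this lets a lower bound on
  \<open>l\<close> be read off an upper bound on its reciprocal. Inversion reverses the order where
  \<open>l\<close> is positive, hence the smaller half-line.\<close>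

lemma eventually_monotone_inverse:
  assumes "eventually_monotone l" and "\<forall>\<^sub>F x in at_top. l x > 0"
  shows "eventually_monotone (\<lambda>x. inverse (l x))"
proof -
  obtain x0 where x0: "mono_on {x0..} l \<or> antimono_on {x0..} l"
    using assms(1) unfolding eventually_monotone_def by blast
  obtain x1 where x1: "\<And>x. x \<ge> x1 \<Longrightarrow> l x > 0"
    using assms(2) unfolding eventually_at_top_linorder by blast
  have "antimono_on {max x0 x1..} (\<lambda>x. inverse (l x)) \<or> mono_on {max x0 x1..} (\<lambda>x. inverse (l x))"
    using x0
  proof (elim disjE)
    assume "mono_on {x0..} l"
    then have "antimono_on {max x0 x1..} (\<lambda>x. inverse (l x))"
      by (intro monotone_onI le_imp_inverse_le x1) (auto elim!: monotone_onD)
    then show ?thesis ..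
  next
    assume "antimono_on {x0..} l"
    then have "mono_on {max x0 x1..} (\<lambda>x. inverse (l x))"
      by (intro monotone_onI le_imp_inverse_le x1) (auto elim!: monotone_onD)
    then show ?thesis ..
  qed
  then show ?thesis unfolding eventually_monotone_def by blast
qed

text \<open>A weak form of Potter's bound. The limit is taken at the ratio 2 and iterated
  dyadically; monotonicity supplies the local boundedness from which the iteration starts.\<close>

lemma slowly_varying_eventually_le_powr:
  fixes \<epsilon> :: real
  assumes sv: "slowly_varying l" and "eventually_monotone l"
    and "\<forall>\<^sub>F x in at_top. l x > 0" and "\<epsilon> > 0"
  shows "\<exists>C. \<forall>\<^sub>F x in at_top. l x \<le> C * x powr \<epsilon>"
proof -
  obtain x0 where x0: "mono_on {x0..} l \<or> antimono_on {x0..} l"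
    using assms(2) unfolding eventually_monotone_def by blast
  have "((\<lambda>x. l (2 * x) / l x) \<longlongrightarrow> 1) at_top"
    using sv unfolding slowly_varying_def by auto
  moreover have "(1::real) < 2 powr \<epsilon>" using \<open>\<epsilon> > 0\<close> by simp
  ultimately have "\<forall>\<^sub>F x in at_top. l (2 * x) / l x < 2 powr \<epsilon>"
    by (rule order_tendstoD)
  with assms(3) have "\<forall>\<^sub>F x in at_top. l (2 * x) \<le> 2 powr \<epsilon> * l x"
    by eventually_elim (simp add: divide_simps)
  from eventually_conj[OF this assms(3)] obtain x1 where x1:
    "\<And>x. x \<ge> x1 \<Longrightarrow> l (2 * x) \<le> 2 powr \<epsilon> * l x" "\<And>x. x \<ge> x1 \<Longrightarrow> l x > 0"
    unfolding eventually_at_top_linorder by blast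
  define z where "z = max 1 (max x0 x1)"
  have z: "z \<ge> 1" "z \<ge> x0" "z \<ge> x1" by (auto simp: z_def)
  \<comment> \<open>A monotone function, in either direction, has its maximum over
    \<open>[z, 2 * z]\<close> at an endpoint.\<close>
  define C where "C = max (l z) (l (2 * z))"
  have C: "C > 0" using x1(2)[of z] z by (auto simp: C_def)
  have base: "l x \<le> C" if "z \<le> x" "x \<le> 2 * z" for x
    using x0
  proof
    assume m: "mono_on {x0..} l"
    have "l x \<le> l (2 * z)" by (rule monotone_onD[OF m]) (use that z in auto)
    then show ?thesis by (simp add: C_def)
  next
    assume m: "antimono_on {x0..} l"
    have "l x \<le> l z" by (rule monotone_onD[OF m]) (use that z in auto)
    then show ?thesis by (simp add: C_def)
  qed
  \<comment> \<open>Induction on the number of doublings, by halving \<open>x\<close>. Points up to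
    \<open>2 * z\<close> are treated by \<open>base\<close>, since their halves may fall below
    \<open>z\<close>; there \<open>x powr \<epsilon> \<ge> 1\<close> because
    \<open>z \<ge> 1\<close>.\<close>
  have step: "l x \<le> C * x powr \<epsilon>" if "z \<le> x" "x \<le> 2 ^ m * z" for m x
    using that
  proof (induction m arbitrary: x)
    case 0
    then have "l x \<le> C * 1" using base[of x] z by simp
    also have "\<dots> \<le> C * x powr \<epsilon>"
      using C 0 z \<open>\<epsilon> > 0\<close> by (intro mult_left_mono ge_one_powr_ge_zero) auto
    finally show ?case .
  next
    case (Suc m)
    show ?case
    proof (cases "x \<le> 2 * z")
      case True
      then have "l x \<le> C * 1" using base[of x] Suc.prems by simp
      also have "\<dots> \<le> C * x powr \<epsilon>"
        using C Suc.prems z \<open>\<epsilon> > 0\<close> by (intro mult_left_mono ge_one_powr_ge_zero) auto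
      finally show ?thesis .
    next
      case False
      then have "l (2 * (x / 2)) \<le> 2 powr \<epsilon> * l (x / 2)" using z by (intro x1) auto
      also have "\<dots> \<le> 2 powr \<epsilon> * (C * (x / 2) powr \<epsilon>)"
        using Suc.prems False by (intro mult_left_mono Suc.IH) auto
      \<comment> \<open>The factor gained by doubling cancels the one lost by halving, so the
        constant does not grow with \<open>m\<close>.\<close>
      also have "\<dots> = C * x powr \<epsilon>" using Suc.prems z by (simp add: powr_divide)
      finally show ?thesis by simp
    qed
  qed
  have "l x \<le> C * x powr \<epsilon>" if x: "x \<ge> z" for x
  proof -
    obtain m where "x / z < 2 ^ m" using real_arch_pow[of 2 "x / z"] by auto
    then show ?thesis using z x by (intro step[of _ m]) (auto simp: divide_simps)
  qed
  then show ?thesis unfolding eventually_at_top_linorder by blast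
qed

lemma slowly_varying_le_powr:
  fixes \<epsilon> :: real
  assumes "slowly_varying l" "eventually_monotone l"
    and pos: "\<And>k::int. k \<ge> 1 \<Longrightarrow> l (of_int k) > 0" and "\<epsilon> > 0"
  shows "\<exists>C>0. \<forall>k::int. k \<ge> 1 \<longrightarrow> l (of_int k) \<le> C * of_int k powr \<epsilon>"
proof -
  obtain C x1 where C: "\<And>x. x \<ge> x1 \<Longrightarrow> l x \<le> C * x powr \<epsilon>"
    using slowly_varying_eventually_le_powr[OF assms(1,2)
        eventually_monotone_imp_eventually_pos[OF assms(2) pos] \<open>\<epsilon> > 0\<close>]
    unfolding eventually_at_top_linorder by blast
  \<comment> \<open>Finitely many integers lie below the threshold; as the values of
    \<open>l\<close> there are positive, their sum dominates each of them. Passing to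
    \<open>max 1 D\<close> below makes the constant positive.\<close>
  define D where "D = max C (\<Sum>k=1..\<lceil>x1\<rceil>. l (of_int k))"
  have "l (of_int k) \<le> max 1 D * of_int k powr \<epsilon>" if k: "k \<ge> 1" for k :: int
  proof (cases "k \<le> \<lceil>x1\<rceil>")
    case True
    have "l (of_int k) \<le> (\<Sum>k=1..\<lceil>x1\<rceil>. l (of_int k))"
      by (rule member_le_sum) (use True k in \<open>auto intro!: less_imp_le[OF pos]\<close>)
    also have "\<dots> \<le> max 1 D * 1" by (simp add: D_def)
    also have "\<dots> \<le> max 1 D * of_int k powr \<epsilon>"
      using k \<open>\<epsilon> > 0\<close> by (intro mult_left_mono ge_one_powr_ge_zero) auto
    finally show ?thesis .
  next
    case False
    then have "l (of_int k) \<le> C * of_int k powr \<epsilon>" by (intro C) linarith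
    also have "\<dots> \<le> max 1 D * of_int k powr \<epsilon>" by (intro mult_right_mono) (auto simp: D_def)
    finally show ?thesis .
  qed
  then show ?thesis by (intro exI[of _ "max 1 D"]) auto
qed

section \<open>Power bounds for the mass function\<close>

lemma regularly_varying_pmf_upper:
  fixes \<epsilon> :: real
  assumes "regularly_varying_pmf f \<gamma>" and pos: "\<And>k. k > 0 \<Longrightarrow> f k > 0" and "\<epsilon> > 0"
  shows "\<exists>C>0. \<forall>k::int. 1 \<le> k \<longrightarrow> f k \<le> C * of_int k powr (\<epsilon> - \<gamma> - 1)"
proof -
  obtain l where l: "slowly_varying l" "eventually_monotone l"
    "\<And>k::int. k \<ge> 1 \<Longrightarrow> f k = l (of_int k) * of_int k powr (- \<gamma> - 1)"
    using assms(1) unfolding regularly_varying_pmf_def by blast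
  \<comment> \<open>The power of \<open>k\<close> is positive, so \<open>l\<close> inherits its sign
    from \<open>f\<close>.\<close>
  have "l (of_int k) > 0" if "k \<ge> 1" for k :: int
    using pos[of k] l(3)[OF that] that by (auto simp: zero_less_mult_iff)
  from slowly_varying_le_powr[OF l(1,2) this \<open>\<epsilon> > 0\<close>] obtain C where C: "C > 0"
    "\<And>k::int. k \<ge> 1 \<Longrightarrow> l (of_int k) \<le> C * of_int k powr \<epsilon>" by auto
  have "f k \<le> C * of_int k powr (\<epsilon> - \<gamma> - 1)" if k: "k \<ge> 1" for k :: int
  proof -
    have "f k \<le> (C * of_int k powr \<epsilon>) * of_int k powr (- \<gamma> - 1)"
      unfolding l(3)[OF k] by (intro mult_right_mono C k) auto
    also have "\<dots> = C * of_int k powr (\<epsilon> - \<gamma> - 1)"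
      by (simp add: powr_add[symmetric] algebra_simps)
    finally show ?thesis .
  qed
  with C(1) show ?thesis by blast
qed

text \<open>The upper power bound applied to the reciprocal of \<open>l\<close>, then
  inverted.\<close>

lemma regularly_varying_pmf_lower:
  fixes \<epsilon> :: real
  assumes "regularly_varying_pmf f \<gamma>" and pos: "\<And>k. k > 0 \<Longrightarrow> f k > 0" and "\<epsilon> > 0"
  shows "\<exists>c>0. \<forall>k::int. 1 \<le> k \<longrightarrow> c * of_int k powr (- \<epsilon> - \<gamma> - 1) \<le> f k"
proof -
  obtain l where l: "slowly_varying l" "eventually_monotone l"
    "\<And>k::int. k \<ge> 1 \<Longrightarrow> f k = l (of_int k) * of_int k powr (- \<gamma> - 1)"
    using assms(1) unfolding regularly_varying_pmf_def by blast
  have lpos: "l (of_int k) > 0" if "k \<ge> 1" for k :: int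
    using pos[of k] l(3)[OF that] that by (auto simp: zero_less_mult_iff)
  have "eventually_monotone (\<lambda>x. inverse (l x))"
    by (intro eventually_monotone_inverse eventually_monotone_imp_eventually_pos l lpos)
  from slowly_varying_le_powr[OF slowly_varying_inverse[OF l(1)] this _ \<open>\<epsilon> > 0\<close>]
  obtain C where C: "C > 0" "\<And>k::int. k \<ge> 1 \<Longrightarrow> inverse (l (of_int k)) \<le> C * of_int k powr \<epsilon>"
    using lpos by auto
  have "inverse C * of_int k powr (- \<epsilon> - \<gamma> - 1) \<le> f k" if k: "k \<ge> 1" for k :: int
  proof -
    have "inverse (C * of_int k powr \<epsilon>) \<le> inverse (inverse (l (of_int k)))"
      by (intro le_imp_inverse_le C k) (use lpos[OF k] in simp)
    then have "inverse C * of_int k powr (- \<epsilon>) \<le> l (of_int k)"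
      by (simp add: powr_minus)
    then have "inverse C * of_int k powr (- \<epsilon>) * of_int k powr (- \<gamma> - 1) \<le> f k"
      unfolding l(3)[OF k] by (intro mult_right_mono) auto
    then show ?thesis
      by (simp add: mult.assoc powr_add[symmetric] algebra_simps)
  qed
  with C(1) show ?thesis by (intro exI[of _ "inverse C"]) auto
qed

section \<open>Hitting and missing probabilities of a sample\<close>

lemma independent_copiesD:
  assumes "prob_space N" "independent_copies M X N Y n" "X \<in> measurable M (count_space UNIV)"
    and i: "i \<in> {1..n}"
  shows independent_copies_measurable: "Y i \<in> measurable N (count_space UNIV)"
    and independent_copies_prob_mass: "prob_mass N (Y i) k = prob_mass M X k"
proof -
  interpret N: prob_space N by fact
  have ind: "N.indep_vars (\<lambda>_. count_space UNIV) Y {1..n}"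
    and d: "distr N (count_space UNIV) (Y i) = distr M (count_space UNIV) X"
    using assms(2) i unfolding independent_copies_def by auto
  show m: "Y i \<in> measurable N (count_space UNIV)"
    using ind i unfolding N.indep_vars_def by auto
  have "measure (distr N (count_space UNIV) (Y i)) {k} = measure (distr M (count_space UNIV) X) {k}"
    by (simp add: d)
  then show "prob_mass N (Y i) k = prob_mass M X k"
    using m assms(3) unfolding prob_mass_def
    by (simp add: measure_distr vimage_def Int_def conj_commute)
qed

lemma sample_event_measurable:
  assumes "prob_space N" "independent_copies M X N Y n" "X \<in> measurable M (count_space UNIV)"
  shows "{\<omega> \<in> space N. k \<in> sample_set Y n \<omega>} \<in> sets N"
proof -
  have "{\<omega> \<in> space N. k \<in> sample_set Y n \<omega>} = (\<Union>i\<in>{1..n}. Y i -` {k} \<inter> space N)"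
    by (auto simp: sample_set_def)
  also have "\<dots> \<in> sets N"
    by (intro sets.finite_UN measurable_sets[OF independent_copies_measurable[OF assms]]) auto
  finally show ?thesis .
qed

text \<open>Union bound over the \<open>n\<close> indices, each contributing the mass at
  \<open>k\<close>.\<close>

lemma prob_sample_hit_le:
  assumes "prob_space N" "independent_copies M X N Y n" "X \<in> measurable M (count_space UNIV)"
  shows "measure N {\<omega> \<in> space N. k \<in> sample_set Y n \<omega>} \<le> n * prob_mass M X k"
proof -
  interpret N: prob_space N by fact
  have "{\<omega> \<in> space N. k \<in> sample_set Y n \<omega>} = (\<Union>i\<in>{1..n}. Y i -` {k} \<inter> space N)"
    by (auto simp: sample_set_def)
  also have "measure N \<dots> \<le> (\<Sum>i\<in>{1..n}. measure N (Y i -` {k} \<inter> space N))"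
    by (intro measure_UNION_le measurable_sets[OF independent_copies_measurable[OF assms]]) auto
  also have "\<dots> = (\<Sum>i\<in>{1..n}. prob_mass N (Y i) k)"
    by (simp add: prob_mass_def vimage_def Int_def conj_commute)
  also have "\<dots> = (\<Sum>i\<in>{1..n}. prob_mass M X k)"
    by (intro sum.cong refl independent_copies_prob_mass[OF assms])
  finally show ?thesis by simp
qed

text \<open>Missing \<open>k\<close> means that every \<open>Y i\<close> falls in the complement of
  \<open>{k}\<close>; by independence these events multiply.\<close>

lemma prob_sample_miss:
  assumes "prob_space N" "independent_copies M X N Y n" "X \<in> measurable M (count_space UNIV)"
    and "n > 0"
  shows "measure N {\<omega> \<in> space N. k \<notin> sample_set Y n \<omega>} = (1 - prob_mass M X k) ^ n"
proof -
  interpret N: prob_space N by fact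
  note m = independent_copies_measurable[OF assms(1-3)]
  have ind: "N.indep_vars (\<lambda>_. count_space UNIV) Y {1..n}"
    using assms(2) unfolding independent_copies_def by auto
  have miss: "measure N (Y i -` (- {k}) \<inter> space N) = 1 - prob_mass M X k" if i: "i \<in> {1..n}" for i
  proof -
    have "Y i -` {k} \<inter> space N \<in> N.events" using m[OF i] by (rule measurable_sets) simp
    then have "N.prob (space N - (Y i -` {k} \<inter> space N)) = 1 - N.prob (Y i -` {k} \<inter> space N)"
      by (rule N.prob_compl)
    moreover have "space N - (Y i -` {k} \<inter> space N) = Y i -` (- {k}) \<inter> space N" by auto
    moreover have "N.prob (Y i -` {k} \<inter> space N) = prob_mass N (Y i) k"
      by (simp add: prob_mass_def vimage_def Int_def conj_commute)
    ultimately show ?thesis using independent_copies_prob_mass[OF assms(1-3) i] by simp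
  qed
  \<comment> \<open>For \<open>n = 0\<close> the intersection would be \<open>UNIV\<close> instead
    of \<open>space N\<close>.\<close>
  have "{\<omega> \<in> space N. k \<notin> sample_set Y n \<omega>} = (\<Inter>i\<in>{1..n}. Y i -` (- {k}) \<inter> space N)"
    using \<open>n > 0\<close> by (auto simp: sample_set_def)
  also have "measure N \<dots> = (\<Prod>i\<in>{1..n}. measure N (Y i -` (- {k}) \<inter> space N))"
    by (rule N.indep_varsD[OF ind]) (use \<open>n > 0\<close> in auto)
  also have "\<dots> = (1 - prob_mass M X k) ^ n" by (simp add: miss)
  finally show ?thesis .
qed

text \<open>Union bound over the missed values: each is missed with probability at most
  \<open>exp (- q) ^ n\<close>, because \<open>1 - q \<le> exp (- q)\<close>.\<close>

lemma prob_sample_cover_ge: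
  assumes "prob_space M" "prob_space N" "independent_copies M X N Y n"
    and "X \<in> measurable M (count_space UNIV)" and "n > 0"
    and q: "\<And>k. 1 \<le> k \<Longrightarrow> k \<le> K \<Longrightarrow> q \<le> prob_mass M X k" and "K \<ge> 0"
  shows "1 - K * exp (- real n * q) \<le> measure N {\<omega> \<in> space N. {1..K} \<subseteq> sample_set Y n \<omega>}"
proof -
  interpret M: prob_space M by fact
  interpret N: prob_space N by fact
  let ?miss = "\<lambda>k. {\<omega> \<in> space N. k \<notin> sample_set Y n \<omega>}"
  have ev: "?miss k \<in> N.events" for k
  proof -
    have "?miss k = space N - {\<omega> \<in> space N. k \<in> sample_set Y n \<omega>}" by auto
    then show ?thesis using sample_event_measurable[OF assms(2-4), of k] by auto
  qed
  have "N.prob (?miss k) \<le> exp (- real n * q)" if "k \<in> {1..K}" for k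
  proof -
    \<comment> \<open>This keeps the base \<open>1 - prob_mass M X k\<close> nonnegative, so that
      taking powers preserves the inequality.\<close>
    have "prob_mass M X k \<le> 1" unfolding prob_mass_def by (rule M.prob_le_1)
    moreover have "1 - prob_mass M X k \<le> exp (- q)"
      using exp_ge_add_one_self[of "- q"] q[of k] that by auto
    ultimately have "(1 - prob_mass M X k) ^ n \<le> exp (- q) ^ n" by (intro power_mono) auto
    then show ?thesis
      using prob_sample_miss[OF assms(2-5), of k] by (simp add: exp_of_nat_mult[symmetric])
  qed
  then have "(\<Sum>k\<in>{1..K}. N.prob (?miss k)) \<le> (\<Sum>k\<in>{1..K}. exp (- real n * q))" by (rule sum_mono)
  moreover have "N.prob (\<Union>k\<in>{1..K}. ?miss k) \<le> (\<Sum>k\<in>{1..K}. N.prob (?miss k))"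
    by (intro measure_UNION_le ev) auto
  ultimately have "N.prob (\<Union>k\<in>{1..K}. ?miss k) \<le> K * exp (- real n * q)"
    using \<open>K \<ge> 0\<close> by simp
  moreover have "(\<Union>k\<in>{1..K}. ?miss k) \<in> N.events" by (intro sets.finite_UN ev) auto
  then have "N.prob (space N - (\<Union>k\<in>{1..K}. ?miss k)) = 1 - N.prob (\<Union>k\<in>{1..K}. ?miss k)"
    by (rule N.prob_compl)
  moreover have "space N - (\<Union>k\<in>{1..K}. ?miss k)
      = {\<omega> \<in> space N. {1..K} \<subseteq> sample_set Y n \<omega>}" by auto
  ultimately show ?thesis by simp
qed

text \<open>Each probability depends on a single sample, so the space \<open>N n\<close> and the
  copies \<open>Y n\<close> may change with \<open>n\<close>, without any relation between samples
  of different sizes.\<close>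

theorem theorem3p1:
  fixes M :: "'a measure" and X :: "'a \<Rightarrow> int" and \<gamma> :: real
    and N :: "nat \<Rightarrow> 'b measure" and Y :: "nat \<Rightarrow> nat \<Rightarrow> 'b \<Rightarrow> int"
  assumes "prob_space M"
    and "X \<in> measurable M (count_space UNIV)"
    and "\<gamma> > 1"
    and "regularly_varying_pmf (prob_mass M X) \<gamma>"
    and "\<And>k. k > 0 \<Longrightarrow> prob_mass M X k > 0"
    and "\<And>n. prob_space (N n)"
    and "\<And>n. independent_copies M X (N n) (Y n) n"
  shows "(\<forall>a. 0 < a \<and> a < 1 / (\<gamma> + 1) \<longrightarrow>
           (\<lambda>n. measure (N n) {\<omega> \<in> space (N n).
              {1..\<lceil>real n powr a\<rceil>} \<subseteq> sample_set (Y n) n \<omega>}) \<longlonglongrightarrow> 1)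
       \<and> (\<forall>a. a > 1 / (\<gamma> + 1) \<longrightarrow>
           (\<lambda>n. measure (N n) {\<omega> \<in> space (N n).
              \<lceil>real n powr a\<rceil> \<in> sample_set (Y n) n \<omega>}) \<longlonglongrightarrow> 0)"
proof (intro conjI allI impI)

  \<comment> \<open>Below the critical exponent: covering an initial segment\<close>
  fix a :: real assume a: "0 < a \<and> a < 1 / (\<gamma> + 1)"
  let ?P = "\<lambda>n. measure (N n) {\<omega> \<in> space (N n). {1..\<lceil>real n powr a\<rceil>} \<subseteq> sample_set (Y n) n \<omega>}"
  \<comment> \<open>Half the gap: \<open>\<epsilon> + \<gamma> + 1\<close> becomes the midpoint of
    \<open>\<gamma> + 1\<close> and \<open>1 / a\<close>, so its product with \<open>a\<close> stays
    below 1.\<close>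
  define \<epsilon> where "\<epsilon> = (1 / a - (\<gamma> + 1)) / 2"
  have \<epsilon>: "\<epsilon> > 0" using a \<open>\<gamma> > 1\<close> by (simp add: \<epsilon>_def field_simps)
  obtain c where c: "c > 0"
    and lower: "\<And>k::int. k \<ge> 1 \<Longrightarrow> c * of_int k powr (- \<epsilon> - \<gamma> - 1) \<le> prob_mass M X k"
    using regularly_varying_pmf_lower[OF assms(4,5) \<epsilon>] by blast
  define s where "s = - \<epsilon> - \<gamma> - 1"
  \<comment> \<open>The exponent of \<open>n\<close> in \<open>n * q\<close>, where
    \<open>q = d * n powr (a * s)\<close> bounds the mass from below on the whole segment. The
    factor \<open>2 powr s\<close> in \<open>d\<close> pays for rounding up.\<close>
  define \<delta> where "\<delta> = 1 + a * s"
  define d where "d = c * 2 powr s"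
  have "\<delta> = (1 - a * (\<gamma> + 1)) / 2"
    using a by (simp add: \<delta>_def s_def \<epsilon>_def field_simps)
  then have \<delta>: "\<delta> > 0" using a \<open>\<gamma> > 1\<close> by (simp add: field_simps)
  have s: "s \<le> 0" using \<epsilon> \<open>\<gamma> > 1\<close> by (simp add: s_def)
  have d: "d > 0" using c by (simp add: d_def)
  have "1 - 2 * n powr a * exp (- d * n powr \<delta>) \<le> ?P n" if "n > 0" for n
  proof -
    let ?K = "\<lceil>real n powr a\<rceil>"
    \<comment> \<open>Rounding up a number that is at least 1 at most doubles it.\<close>
    have "real n powr a \<ge> 1" using \<open>n > 0\<close> a by (intro ge_one_powr_ge_zero) auto
    then have K: "?K \<ge> 1" "?K \<le> 2 * real n powr a" by linarith+
    have q: "d * n powr (a * s) \<le> prob_mass M X k" if k: "1 \<le> k" "k \<le> ?K" for k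
    proof -
      have "d * n powr (a * s) = c * (2 * n powr a) powr s"
        by (simp add: d_def powr_mult powr_powr)
      \<comment> \<open>As \<open>s \<le> 0\<close>, the power decreases in its base, and
        \<open>k\<close> is at most \<open>2 * n powr a\<close>.\<close>
      also have "\<dots> \<le> c * k powr s"
        using c s k K by (intro mult_left_mono powr_mono2') linarith+
      also have "\<dots> \<le> prob_mass M X k" using lower[OF k(1)] by (simp add: s_def)
      finally show ?thesis .
    qed
    have "2 * n powr a * exp (- d * n powr \<delta>) \<ge> ?K * exp (- real n * (d * n powr (a * s)))"
      using K \<open>n > 0\<close> by (intro mult_mono) (auto simp: \<delta>_def powr_add)
    moreover have "1 - ?K * exp (- real n * (d * n powr (a * s))) \<le> ?P n"
      by (rule prob_sample_cover_ge[OF assms(1,6,7,2)]) (use \<open>n > 0\<close> K(1) q in \<open>linarith | blast\<close>)+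
    ultimately show ?thesis by linarith
  qed
  then have ge: "\<forall>\<^sub>F n in sequentially. 1 - 2 * n powr a * exp (- d * n powr \<delta>) \<le> ?P n"
    using eventually_gt_at_top by (rule eventually_mono[rotated])
  have "a > 0" using a by simp
  \<comment> \<open>The stretched exponential beats the polynomial number of values because
    \<open>\<delta> > 0\<close>.\<close>
  then have lim: "(\<lambda>n. 1 - 2 * real n powr a * exp (- d * real n powr \<delta>)) \<longlonglongrightarrow> 1"
    using d \<delta> by real_asymp
  have "?P n \<le> 1" for n
    by (rule prob_space.prob_le_1) fact
  then show "?P \<longlonglongrightarrow> 1"
    by (intro tendsto_sandwich[OF ge _ lim tendsto_const] always_eventually) auto
next

  \<comment> \<open>Above the critical exponent: hitting a single value\<close>
  fix a :: real assume a: "a > 1 / (\<gamma> + 1)"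
  let ?P = "\<lambda>n. measure (N n) {\<omega> \<in> space (N n). \<lceil>real n powr a\<rceil> \<in> sample_set (Y n) n \<omega>}"
  have "a > 0" using a \<open>\<gamma> > 1\<close> by (smt (verit) divide_pos_pos)
  \<comment> \<open>Half the gap again: \<open>\<gamma> + 1 - \<epsilon>\<close> is the midpoint of
    \<open>1 / a\<close> and \<open>\<gamma> + 1\<close>, so its product with \<open>a\<close>
    exceeds 1 and the exponent \<open>\<delta>\<close> of \<open>n\<close> in the union bound is
    negative.\<close>
  define \<epsilon> where "\<epsilon> = (\<gamma> + 1 - 1 / a) / 2"
  have \<epsilon>: "\<epsilon> > 0" using a \<open>a > 0\<close> \<open>\<gamma> > 1\<close> by (simp add: \<epsilon>_def field_simps)
  obtain C where C: "C > 0"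
    and upper: "\<And>k::int. k \<ge> 1 \<Longrightarrow> prob_mass M X k \<le> C * of_int k powr (\<epsilon> - \<gamma> - 1)"
    using regularly_varying_pmf_upper[OF assms(4,5) \<epsilon>] by blast
  define s where "s = \<epsilon> - \<gamma> - 1"
  define \<delta> where "\<delta> = 1 + a * s"
  have "\<delta> = (1 - a * (\<gamma> + 1)) / 2"
    using \<open>a > 0\<close> by (simp add: \<delta>_def s_def \<epsilon>_def field_simps)
  then have \<delta>: "\<delta> < 0" using a \<open>\<gamma> > 1\<close> by (simp add: field_simps)
  then have "a * s < 0" by (simp add: \<delta>_def)
  then have s: "s \<le> 0" using \<open>a > 0\<close> by (simp add: mult_less_0_iff)
  \<comment> \<open>At \<open>n = 0\<close> the ceiling is 0, outside the range of
    \<open>upper\<close>.\<close>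
  have "?P n \<le> C * n powr \<delta>" if "n > 0" for n
  proof -
    let ?K = "\<lceil>real n powr a\<rceil>"
    have n: "real n powr a > 0" using \<open>n > 0\<close> by simp
    then have K: "?K \<ge> 1" "?K \<ge> real n powr a" by linarith+
    have "prob_mass M X ?K \<le> C * ?K powr s" using upper[OF K(1)] by (simp add: s_def)
    \<comment> \<open>As \<open>s \<le> 0\<close>, dropping the ceiling only increases the power, so
      rounding costs no factor here.\<close>
    also have "\<dots> \<le> C * (n powr a) powr s"
      using C s K n by (intro mult_left_mono powr_mono2') auto
    finally have "n * prob_mass M X ?K \<le> n * (C * n powr (a * s))"
      by (intro mult_left_mono) (auto simp: powr_powr)
    also have "\<dots> = C * n powr \<delta>" using \<open>n > 0\<close> by (simp add: \<delta>_def powr_add)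
    finally show ?thesis using prob_sample_hit_le[OF assms(6,7,2), of n ?K] by linarith
  qed
  then have le: "\<forall>\<^sub>F n in sequentially. ?P n \<le> C * n powr \<delta>"
    using eventually_gt_at_top by (rule eventually_mono[rotated])
  have lim: "(\<lambda>n. C * real n powr \<delta>) \<longlonglongrightarrow> 0"
    using \<delta> by real_asymp
  show "?P \<longlonglongrightarrow> 0"
    by (intro tendsto_sandwich[OF _ le tendsto_const lim] always_eventually) auto
qed

end
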